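(* No function is $m$-complete for the class of functions approximable from below: for every total function $f$ approximable from below there is a total function $j$ approximable from below such that there is no total computable $h$ with $j=f\circ h$.
   Context: A total $f:\omega\to\omega$ is approximable from below if $f(x)=\lim_s g(x,s)$ for some total computable $g$ with $g(x,s+1)\ge g(x,s)$ for all $x,s$ (and the limit exists for each $x$). A function $\psi$ is $m$-complete for a class $\Gamma$ if $\psi\in\Gamma$ and every $\varphi\in\Gamma$ satisfies $\varphi=\psi\circ h$ for some total computable $h$. *)

theory Defs
  imports Complex_Main
begin

text \<open>
  Computability is rendered by the partial recursive functions of Kleene. Functions of \<open>k\<close>
  arguments act on lists of length \<open>k\<close>. Arities are not tracked in the syntax: an ill-formed term
  merely has no value on the argument lists that do not fit.
\<close>

datatype recf =
    Zero
  | Succ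
  | Proj nat
  | Comp recf "recf list"
  | PrimRec recf recf
  | Mu recf

text \<open>
  \<open>evaluates r xs y\<close>: the partial function denoted by \<open>r\<close> is defined at \<open>xs\<close> with value \<open>y\<close>.
  The recursion variable of \<open>PrimRec\<close> and the search variable of \<open>Mu\<close> come first; \<open>Mu\<close> requires
  all earlier values to be defined and nonzero.
\<close>

inductive evaluates :: "recf \<Rightarrow> nat list \<Rightarrow> nat \<Rightarrow> bool" where
  zero: "evaluates Zero xs 0"
| succ: "evaluates Succ [x] (Suc x)"
| proj: "i < length xs \<Longrightarrow> evaluates (Proj i) xs (xs ! i)"
| comp: "list_all2 (\<lambda>g y. evaluates g xs y) gs ys \<Longrightarrow> evaluates f ys z \<Longrightarrow>
    evaluates (Comp f gs) xs z"
| primrec_0: "evaluates f xs z \<Longrightarrow> evaluates (PrimRec f g) (0 # xs) z"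
| primrec_Suc: "evaluates (PrimRec f g) (n # xs) y \<Longrightarrow> evaluates g (n # y # xs) z \<Longrightarrow>
    evaluates (PrimRec f g) (Suc n # xs) z"
| mu: "evaluates f (n # xs) 0 \<Longrightarrow> (\<forall>i<n. \<exists>y. evaluates f (i # xs) (Suc y)) \<Longrightarrow>
    evaluates (Mu f) xs n"

lemma evaluates_unique:
  "evaluates r xs y \<Longrightarrow> evaluates r xs z \<Longrightarrow> y = z"
proof (induction r xs y arbitrary: z rule: evaluates.induct)
  case (zero xs)
  then show ?case by (auto elim: evaluates.cases)
next
  case (succ x)
  then show ?case by (auto elim: evaluates.cases)
next
  case (proj i xs)
  from proj.prems show ?case by (cases rule: evaluates.cases) auto
next
  case (comp xs gs ys f w)
  from comp.prems obtain ys' where ys': "list_all2 (\<lambda>g y. evaluates g xs y) gs ys'"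
    and f: "evaluates f ys' z"
    by (cases rule: evaluates.cases) auto
  have "ys = ys'"
    using comp.IH(1) ys' by (auto simp: list_all2_conv_all_nth intro!: nth_equalityI)
  then show ?case using comp.IH(2) f by blast
next
  case (primrec_0 f xs w g)
  from primrec_0.prems show ?case
    by (cases rule: evaluates.cases) (auto intro: primrec_0.IH)
next
  case (primrec_Suc f g n xs y w)
  from primrec_Suc.prems obtain y' where "evaluates (PrimRec f g) (n # xs) y'"
    and "evaluates g (n # y' # xs) z"
    by (cases rule: evaluates.cases) auto
  then show ?case using primrec_Suc.IH by blast
next
  case (mu f n xs)
  from mu.prems have "evaluates f (z # xs) 0"
    and "\<forall>i<z. \<exists>y. evaluates f (i # xs) (Suc y)"
    by (cases rule: evaluates.cases; auto)+
  then show ?case using mu.IH by (metis nat.distinct(1) linorder_neqE_nat)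
qed

definition computable :: "(nat \<Rightarrow> nat) \<Rightarrow> bool" where
  "computable h \<longleftrightarrow> (\<exists>r. \<forall>x. evaluates r [x] (h x))"

definition computable2 :: "(nat \<Rightarrow> nat \<Rightarrow> nat) \<Rightarrow> bool" where
  "computable2 g \<longleftrightarrow> (\<exists>r. \<forall>x s. evaluates r [x, s] (g x s))"

text \<open>The limit is taken in the order topology of \<open>nat\<close>, which is discrete.\<close>

definition approximable_from_below :: "(nat \<Rightarrow> nat) \<Rightarrow> bool" where
  "approximable_from_below f \<longleftrightarrow>
     (\<exists>g. computable2 g \<and> (\<forall>x s. g x s \<le> g x (Suc s)) \<and> (\<forall>x. (\<lambda>s. g x s) \<longlonglongrightarrow> f x))"

definition m_complete :: "(nat \<Rightarrow> 'a) set \<Rightarrow> (nat \<Rightarrow> 'a) \<Rightarrow> bool" where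
  "m_complete \<Gamma> \<psi> \<longleftrightarrow> \<psi> \<in> \<Gamma> \<and> (\<forall>\<phi>\<in>\<Gamma>. \<exists>h. computable h \<and> \<phi> = \<psi> \<circ> h)"

end

theory Submission imports Defs "HOL-Library.Nat_Bijection" begin

text \<open>
  Diagonalization: put \<open>j e = f (h e) + 1\<close> if the \<open>e\<close>-th partial recursive function \<open>h\<close> halts at
  \<open>e\<close>, and \<open>j e = 0\<close> otherwise. An approximation \<open>g\<close> of \<open>f\<close> from below yields one of \<open>j\<close>, which stays
  at 0 until the computation of \<open>h e\<close> is found and follows \<open>g (h e) s + 1\<close> from then on.
  The enumeration of the partial recursive functions comes from a T predicate that checks
  coded derivations of \<^const>\<open>evaluates\<close>.
\<close>

section \<open>Closure properties of the recursive functions\<close>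

text \<open>Only lists of length \<open>k\<close> matter; values of \<open>F\<close> elsewhere are
  arbitrary. Predicates enter below through their characteristic functions, with 1 for true.\<close>

definition recursive :: "nat \<Rightarrow> (nat list \<Rightarrow> nat) \<Rightarrow> bool" where
  "recursive k F \<longleftrightarrow> (\<exists>r. \<forall>xs. length xs = k \<longrightarrow> evaluates r xs (F xs))"

definition decidable :: "nat \<Rightarrow> (nat list \<Rightarrow> bool) \<Rightarrow> bool" where
  "decidable k P \<longleftrightarrow> recursive k (\<lambda>xs. of_bool (P xs))"

lemma recursive_cong:
  assumes "recursive k F" "\<And>xs. length xs = k \<Longrightarrow> F xs = G xs"
  shows "recursive k G"
  using assms unfolding recursive_def by metis

lemma recursive_comp:
  assumes F: "recursive (length Gs) F" and Gs: "\<forall>G\<in>set Gs. recursive k G"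
  shows "recursive k (\<lambda>xs. F (map (\<lambda>G. G xs) Gs))"
proof -
  obtain f where f: "\<And>ys. length ys = length Gs \<Longrightarrow> evaluates f ys (F ys)"
    using F unfolding recursive_def by blast
  obtain c where c: "\<And>G xs. G \<in> set Gs \<Longrightarrow> length xs = k \<Longrightarrow> evaluates (c G) xs (G xs)"
    using Gs unfolding recursive_def by metis
  have "evaluates (Comp f (map c Gs)) xs (F (map (\<lambda>G. G xs) Gs))" if "length xs = k" for xs
    using that by (intro comp[where ys = "map (\<lambda>G. G xs) Gs"])
      (auto simp: list_all2_conv_all_nth intro: c f)
  then show ?thesis unfolding recursive_def by blast
qed

lemma recursive_nth: "i < k \<Longrightarrow> recursive k (\<lambda>xs. xs ! i)"
  unfolding recursive_def by (metis proj)

text \<open>Weakening, by composition with the projections from \<open>m\<close> on. Recursion and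
  search bind new variables at the front of the argument list, so the old parameters have to be read
  from a tail.\<close>

lemma recursive_drop:
  assumes "recursive k F"
  shows "recursive (m + k) (\<lambda>xs. F (drop m xs))"
proof (rule recursive_cong[OF recursive_comp])
  let ?Gs = "map (\<lambda>i xs. xs ! (m + i)) [0..<k]"
  show "recursive (length ?Gs) F" using assms by simp
  show "\<forall>G\<in>set ?Gs. recursive (m + k) G" by (auto intro: recursive_nth)
  show "F (map (\<lambda>G. G xs) ?Gs) = F (drop m xs)" if "length xs = m + k" for xs :: "nat list"
    using that by (intro arg_cong[of _ _ F] nth_equalityI) auto
qed

lemma recursive_tl: "recursive k F \<Longrightarrow> recursive (Suc k) (\<lambda>xs. F (tl xs))"
  using recursive_drop[of k F 1] by (simp add: drop_Suc)

lemma recursive_nth_tl: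
  "Suc i < k \<Longrightarrow> recursive k (\<lambda>xs. tl xs ! i)"
  "Suc (Suc i) < k \<Longrightarrow> recursive k (\<lambda>xs. tl (tl xs) ! i)"
  by (rule recursive_cong[OF recursive_nth[of "Suc i"]]
        recursive_cong[OF recursive_nth[of "Suc (Suc i)"]]; simp add: nth_tl)+

lemma recursive_const: "recursive k (\<lambda>xs. c)"
proof (induction c)
  case 0
  show ?case unfolding recursive_def by (metis zero)
next
  case (Suc c)
  have "recursive (length [\<lambda>xs. c]) (\<lambda>ys. Suc (ys ! 0))"
    unfolding recursive_def
    by (auto intro!: exI[of _ Succ] simp: length_Suc_conv intro: succ)
  from recursive_comp[OF this] Suc show ?case by simp
qed

lemma recursive_app1:
  assumes "computable f" "recursive k A"
  shows "recursive k (\<lambda>xs. f (A xs))"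
proof -
  have "recursive (length [A]) (\<lambda>ys. f (ys ! 0))"
    using assms(1) unfolding recursive_def computable_def by (fastforce simp: length_Suc_conv)
  from recursive_comp[OF this] assms show ?thesis by simp
qed

lemma recursive_app2:
  assumes "computable2 f" "recursive k A" "recursive k B"
  shows "recursive k (\<lambda>xs. f (A xs) (B xs))"
proof -
  have "recursive (length [A, B]) (\<lambda>ys. f (ys ! 0) (ys ! 1))"
    using assms(1) unfolding recursive_def computable2_def by (fastforce simp: length_Suc_conv)
  from recursive_comp[OF this] assms show ?thesis by simp
qed

lemma computable2I: "recursive 2 (\<lambda>xs. f (xs ! 0) (xs ! 1)) \<Longrightarrow> computable2 f"
  unfolding recursive_def computable2_def by (fastforce dest: spec[of _ "[_, _]"])

lemma recursive_Suc: "recursive k A \<Longrightarrow> recursive k (\<lambda>xs. Suc (A xs))"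
  by (rule recursive_app1) (auto simp: computable_def intro: succ)

section \<open>Primitive recursion and arithmetic\<close>

lemma recursive_rec_nat:
  assumes A: "recursive k A"
    and G: "recursive (Suc (Suc k)) (\<lambda>xs. G (xs ! 0) (xs ! 1) (tl (tl xs)))"
    and B: "recursive k B"
  shows "recursive k (\<lambda>xs. rec_nat (A xs) (\<lambda>n y. G n y xs) (B xs))"
proof -
  obtain a where a: "\<And>xs. length xs = k \<Longrightarrow> evaluates a xs (A xs)"
    using A unfolding recursive_def by blast
  obtain g where g: "\<And>xs. length xs = Suc (Suc k) \<Longrightarrow> evaluates g xs (G (xs ! 0) (xs ! 1) (tl (tl xs)))"
    using G unfolding recursive_def by blast
  have "evaluates (PrimRec a g) (n # xs) (rec_nat (A xs) (\<lambda>n y. G n y xs) n)"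
    if "length xs = k" for n xs
  proof (induction n)
    case 0
    show ?case by (simp add: primrec_0 a that)
  next
    case (Suc n)
    from primrec_Suc[OF this] g[of "n # rec_nat (A xs) (\<lambda>n y. G n y xs) n # xs"] that
    show ?case by simp
  qed
  then have "recursive (Suc k) (\<lambda>ys. rec_nat (A (tl ys)) (\<lambda>n y. G n y (tl ys)) (ys ! 0))"
    unfolding recursive_def by (fastforce simp: length_Suc_conv)
  then have "recursive (length (B # map (\<lambda>i xs. xs ! i) [0..<k]))
      (\<lambda>ys. rec_nat (A (tl ys)) (\<lambda>n y. G n y (tl ys)) (ys ! 0))"
    by simp
  \<comment> \<open>Composing with \<open>B\<close> in the recursion position and all
    \<open>k\<close> projections behind it turns the function of \<open>Suc k\<close> arguments into
    one of \<open>k\<close> arguments. The list of all projections of \<open>xs\<close> is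
    \<open>xs\<close> itself.\<close>
  from recursive_comp[OF this, of k] B
  have "recursive k (\<lambda>xs. rec_nat (A (map (\<lambda>i. xs ! i) [0..<k]))
      (\<lambda>n y. G n y (map (\<lambda>i. xs ! i) [0..<k])) (B xs))"
    by (simp add: comp_def recursive_nth)
  then show ?thesis
    by (rule recursive_cong) (metis map_nth)
qed

lemma recursive_if:
  assumes "decidable k P" "recursive k A" "recursive k B"
  shows "recursive k (\<lambda>xs. if P xs then A xs else B xs)"
proof -
  \<comment> \<open>Recursion over a truth value: zero steps leave \<open>B xs\<close>, and a single
    step replaces it by \<open>A xs\<close>.\<close>
  have "recursive k (\<lambda>xs. rec_nat (B xs) (\<lambda>n y. A xs) (of_bool (P xs)))"
    using assms unfolding decidable_def
    by (intro recursive_rec_nat recursive_tl)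
  then show ?thesis by (rule recursive_cong) simp
qed

lemma recursive_add:
  assumes "recursive k A" "recursive k B"
  shows "recursive k (\<lambda>xs. A xs + B xs)"
proof -
  have "rec_nat m (\<lambda>_. Suc) n = m + n" for m n :: nat by (induction n) auto
  moreover have "recursive k (\<lambda>xs. rec_nat (A xs) (\<lambda>_ y. Suc y) (B xs))"
    by (intro recursive_rec_nat recursive_Suc recursive_nth assms) simp
  ultimately show ?thesis by simp
qed

lemma recursive_minus:
  assumes "recursive k A" "recursive k B"
  shows "recursive k (\<lambda>xs. A xs - B xs)"
proof -
  \<comment> \<open>The predecessor is the recursion that returns its counter; truncated subtraction
    then iterates it.\<close>
  have pred: "recursive l (\<lambda>xs. C xs - 1)" if "recursive l C" for l C
  proof -
    have "rec_nat 0 (\<lambda>n y. n) m = m - 1" for m :: nat by (cases m) auto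
    moreover have "recursive l (\<lambda>xs. rec_nat 0 (\<lambda>n y. n) (C xs))"
      by (intro recursive_rec_nat recursive_const recursive_nth that) simp
    ultimately show ?thesis by simp
  qed
  have "rec_nat m (\<lambda>_ y. y - 1) n = m - n" for m n :: nat by (induction n) auto
  moreover have "recursive k (\<lambda>xs. rec_nat (A xs) (\<lambda>_ y. y - 1) (B xs))"
    by (intro recursive_rec_nat pred recursive_nth assms) simp
  ultimately show ?thesis by simp
qed

section \<open>Decidable predicates, minimization and bounded quantifiers\<close>

lemma decidable_eq_0: "recursive k A \<Longrightarrow> decidable k (\<lambda>xs. A xs = 0)"
  unfolding decidable_def
  by (rule recursive_cong[of _ "\<lambda>xs. 1 - A xs"]) (auto intro: recursive_minus recursive_const)

lemma decidable_le:
  assumes "recursive k A" "recursive k B"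
  shows "decidable k (\<lambda>xs. A xs \<le> B xs)"
  using decidable_eq_0[OF recursive_minus[OF assms]] by simp

lemma decidable_not: "decidable k P \<Longrightarrow> decidable k (\<lambda>xs. \<not> P xs)"
  using decidable_eq_0[of k "\<lambda>xs. of_bool (P xs)"] by (simp add: decidable_def)

lemma decidable_less:
  assumes "recursive k A" "recursive k B"
  shows "decidable k (\<lambda>xs. A xs < B xs)"
  using decidable_not[OF decidable_le[OF assms(2,1)]] by (simp add: not_le)

lemma decidable_conj:
  assumes "decidable k P" "decidable k Q"
  shows "decidable k (\<lambda>xs. P xs \<and> Q xs)"
  unfolding decidable_def
  by (rule recursive_cong[OF recursive_if[OF assms(1) _ recursive_const[of k 0]]])
    (use assms(2) in \<open>auto simp: decidable_def\<close>)

lemma decidable_disj: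
  assumes "decidable k P" "decidable k Q"
  shows "decidable k (\<lambda>xs. P xs \<or> Q xs)"
  using decidable_not[OF decidable_conj[OF assms[THEN decidable_not]]] by simp

lemma decidable_eq:
  assumes "recursive k A" "recursive k B"
  shows "decidable k (\<lambda>xs. A xs = B xs)"
  using decidable_conj[OF decidable_le[OF assms] decidable_le[OF assms(2,1)]]
  by (simp flip: order_eq_iff)

lemma recursive_Least:
  assumes P: "decidable (Suc k) (\<lambda>xs. P (xs ! 0) (tl xs))"
    and ex: "\<And>xs. length xs = k \<Longrightarrow> \<exists>n. P n xs"
  shows "recursive k (\<lambda>xs. LEAST n. P n xs)"
proof -
  \<comment> \<open>\<open>Mu\<close> looks for a zero, so \<open>p\<close> computes the negation:
    it is 0 where \<open>P\<close> holds and \<open>Suc 0\<close> at every earlier argument.\<close>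
  obtain p where p: "\<And>xs. length xs = Suc k \<Longrightarrow> evaluates p xs (of_bool (\<not> P (xs ! 0) (tl xs)))"
    using decidable_not[OF P] unfolding decidable_def recursive_def by blast
  have "evaluates (Mu p) xs (LEAST n. P n xs)" if len: "length xs = k" for xs
  proof (rule mu)
    show "evaluates p ((LEAST n. P n xs) # xs) 0"
      using p[of "(LEAST n. P n xs) # xs"] LeastI_ex[OF ex[OF len]] len by simp
    show "\<forall>i<(LEAST n. P n xs). \<exists>y. evaluates p (i # xs) (Suc y)"
    proof (intro allI impI)
      fix i assume "i < (LEAST n. P n xs)"
      then show "\<exists>y. evaluates p (i # xs) (Suc y)"
        using p[of "i # xs"] len not_less_Least[of i "\<lambda>n. P n xs"] by auto
    qed
  qed
  then show ?thesis unfolding recursive_def by blast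
qed

text \<open>The alternative \<open>i = B xs\<close> makes the search total; it stops strictly below
  \<open>B xs\<close> exactly when it meets a true witness.\<close>

lemma decidable_ex_less:
  assumes "recursive k B" "decidable (Suc k) (\<lambda>xs. P (xs ! 0) (tl xs))"
  shows "decidable k (\<lambda>xs. \<exists>i<B xs. P i xs)"
proof -
  have "(LEAST i. P i xs \<or> i = B xs) < B xs \<longleftrightarrow> (\<exists>i<B xs. P i xs)" for xs
  proof
    assume "(LEAST i. P i xs \<or> i = B xs) < B xs"
    then show "\<exists>i<B xs. P i xs"
      using LeastI[of "\<lambda>i. P i xs \<or> i = B xs" "B xs"] by auto
  next
    assume "\<exists>i<B xs. P i xs"
    then obtain i where "i < B xs" "P i xs" by blast
    then show "(LEAST i. P i xs \<or> i = B xs) < B xs"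
      using Least_le[of "\<lambda>i. P i xs \<or> i = B xs" i] by linarith
  qed
  moreover have "decidable k (\<lambda>xs. (LEAST i. P i xs \<or> i = B xs) < B xs)"
    by (intro decidable_less recursive_Least decidable_disj decidable_eq recursive_nth assms
        assms(1)[THEN recursive_tl]) auto
  ultimately show ?thesis by simp
qed

lemma decidable_all_less:
  assumes "recursive k B" "decidable (Suc k) (\<lambda>xs. P (xs ! 0) (tl xs))"
  shows "decidable k (\<lambda>xs. \<forall>i<B xs. P i xs)"
  using decidable_not[OF decidable_ex_less[OF assms(1) decidable_not[OF assms(2)]]] by simp

section \<open>Pairing and its inverses\<close>

lemma recursive_prod_encode:
  assumes "recursive k A" "recursive k B"
  shows "recursive k (\<lambda>xs. prod_encode (A xs, B xs))"
proof -
  \<comment> \<open>Cantor pairing sends \<open>(a, b)\<close> to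
    \<open>triangle (a + b) + a\<close>.\<close>
  have "rec_nat 0 (\<lambda>n y. y + Suc n) m = triangle m" for m by (induction m) auto
  moreover have "recursive k (\<lambda>xs. rec_nat 0 (\<lambda>n y. y + Suc n) (A xs + B xs) + A xs)"
    by (intro recursive_rec_nat recursive_add recursive_Suc recursive_const recursive_nth assms) auto
  ultimately show ?thesis by (simp add: prod_encode_def)
qed

abbreviation fst_code :: "nat \<Rightarrow> nat" where "fst_code n \<equiv> fst (prod_decode n)"
abbreviation snd_code :: "nat \<Rightarrow> nat" where "snd_code n \<equiv> snd (prod_decode n)"

lemma prod_encode_fst_snd: "prod_encode (fst_code n, snd_code n) = n"
  by simp

text \<open>Decoding inverts the pairing by search. A component never exceeds the code, so the other
  component can be sought below \<open>Suc n\<close>.\<close>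

lemma recursive_fst_code:
  assumes "recursive k A"
  shows "recursive k (\<lambda>xs. fst_code (A xs))"
proof -
  have ex: "\<exists>b<Suc n. prod_encode (fst_code n, b) = n" for n
    using le_prod_encode_2[of "snd_code n" "fst_code n"]
    by (intro exI[of _ "snd_code n"]) auto
  have "fst_code n = (LEAST a. \<exists>b<Suc n. prod_encode (a, b) = n)" for n
    by (rule sym, rule Least_equality) (use ex in auto)
  moreover have "recursive k (\<lambda>xs. LEAST a. \<exists>b<Suc (A xs). prod_encode (a, b) = A xs)"
    by (intro recursive_Least decidable_ex_less decidable_eq recursive_prod_encode recursive_nth
        recursive_nth_tl recursive_Suc assms assms[THEN recursive_tl]
        assms[THEN recursive_tl, THEN recursive_tl]) (use ex in blast)+
  ultimately show ?thesis by simp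
qed

lemma recursive_snd_code:
  assumes "recursive k A"
  shows "recursive k (\<lambda>xs. snd_code (A xs))"
proof -
  have "snd_code n = (LEAST b. prod_encode (fst_code n, b) = n)" for n
    by (rule sym, rule Least_equality) (simp, metis order_refl prod_encode_inverse snd_conv)
  moreover have "recursive k (\<lambda>xs. LEAST b. prod_encode (fst_code (A xs), b) = A xs)"
    by (intro recursive_Least decidable_eq recursive_prod_encode recursive_nth
        recursive_fst_code assms assms[THEN recursive_tl]) (auto intro: prod_encode_fst_snd)
  ultimately show ?thesis by simp
qed

section \<open>Coded lists\<close>

text \<open>This mirrors \<open>list_encode\<close>, where 0 codes the empty list and a nonempty
  list is the successor of a pair; hence the \<open>n - 1\<close> in the head and tail
  functions.\<close>

definition cons_code :: "nat \<Rightarrow> nat \<Rightarrow> nat" where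
  "cons_code x n = Suc (prod_encode (x, n))"

definition hd_code :: "nat \<Rightarrow> nat" where
  "hd_code n = fst_code (n - 1)"

definition tl_code :: "nat \<Rightarrow> nat" where
  "tl_code n = snd_code (n - 1)"

definition drop_code :: "nat \<Rightarrow> nat \<Rightarrow> nat" where
  "drop_code n i = rec_nat n (\<lambda>_. tl_code) i"

definition nth_code :: "nat \<Rightarrow> nat \<Rightarrow> nat" where
  "nth_code n i = hd_code (drop_code n i)"

definition length_code :: "nat \<Rightarrow> nat" where
  "length_code n = (LEAST i. drop_code n i = 0)"

definition mem_code :: "nat \<Rightarrow> nat \<Rightarrow> bool" where
  "mem_code t n \<longleftrightarrow> (\<exists>i<length_code n. nth_code n i = t)"

lemma cons_code [simp]: "cons_code x (list_encode xs) = list_encode (x # xs)"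
  by (simp add: cons_code_def)

lemma hd_code [simp]: "hd_code (list_encode (x # xs)) = x"
  by (simp add: hd_code_def)

lemma tl_code [simp]: "tl_code (list_encode xs) = list_encode (tl xs)"
proof (cases xs)
  case Nil
  \<comment> \<open>Since \<open>0 - 1 = 0\<close>, the tail of the empty list is again empty, in
    agreement with \<open>tl\<close>; dropping past the end therefore stays at 0.\<close>
  have "prod_decode 0 = (0, 0)" using prod_encode_inverse[of "(0, 0)"] by (simp add: prod_encode_def)
  with Nil show ?thesis by (simp add: tl_code_def)
qed (simp add: tl_code_def)

lemma list_encode_eq_0 [simp]: "list_encode xs = 0 \<longleftrightarrow> xs = []"
  by (cases xs) auto

lemma drop_code [simp]: "drop_code (list_encode xs) i = list_encode (drop i xs)"
  by (induction i) (auto simp: drop_code_def tl_drop drop_Suc)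

lemma nth_code [simp]: "i < length xs \<Longrightarrow> nth_code (list_encode xs) i = xs ! i"
  by (simp add: nth_code_def Cons_nth_drop_Suc[symmetric] del: list_encode.simps)

lemma length_code [simp]: "length_code (list_encode xs) = length xs"
  unfolding length_code_def by (rule Least_equality) auto

lemma mem_code [simp]: "mem_code t (list_encode xs) \<longleftrightarrow> t \<in> set xs"
  by (auto simp: mem_code_def in_set_conv_nth)

text \<open>Each cons increases the code beyond both components. This is what later bounds the
  quantifiers over facts in a coded list.\<close>

lemma mem_code_less: "mem_code t n \<Longrightarrow> t < n"
proof -
  have "t \<in> set xs \<Longrightarrow> t < list_encode xs" for xs
  proof (induction xs)
    case (Cons x xs)
    then show ?case
      using le_prod_encode_1[of x "list_encode xs"] le_prod_encode_2[of "list_encode xs" x] by auto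
  qed simp
  then show "mem_code t n \<Longrightarrow> t < n"
    by (metis list_decode_inverse mem_code)
qed

lemmas recursive_rules1 =
  recursive_nth recursive_nth_tl recursive_const recursive_Suc recursive_add recursive_minus
  recursive_prod_encode recursive_fst_code recursive_snd_code recursive_if
  decidable_le decidable_less decidable_eq decidable_not decidable_conj decidable_disj
  decidable_ex_less decidable_all_less

lemma recursive_cons_code:
  "recursive k A \<Longrightarrow> recursive k B \<Longrightarrow> recursive k (\<lambda>xs. cons_code (A xs) (B xs))"
  unfolding cons_code_def by (intro recursive_rules1)

lemma recursive_hd_code: "recursive k A \<Longrightarrow> recursive k (\<lambda>xs. hd_code (A xs))"
  unfolding hd_code_def by (intro recursive_rules1)

lemma recursive_tl_code: "recursive k A \<Longrightarrow> recursive k (\<lambda>xs. tl_code (A xs))"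
  unfolding tl_code_def by (intro recursive_rules1)

lemma recursive_drop_code:
  "recursive k A \<Longrightarrow> recursive k B \<Longrightarrow> recursive k (\<lambda>xs. drop_code (A xs) (B xs))"
  unfolding drop_code_def by (intro recursive_rec_nat recursive_tl_code recursive_nth) auto

lemma recursive_nth_code:
  "recursive k A \<Longrightarrow> recursive k B \<Longrightarrow> recursive k (\<lambda>xs. nth_code (A xs) (B xs))"
  unfolding nth_code_def by (intro recursive_hd_code recursive_drop_code)

lemma recursive_length_code:
  assumes "recursive k A"
  shows "recursive k (\<lambda>xs. length_code (A xs))"
proof -
  have "\<exists>i. drop_code n i = 0" for n
    by (metis drop_code drop_all list_encode_eq_0 list_decode_inverse order_refl)
  then show ?thesis
    unfolding length_code_def
    by (intro recursive_Least decidable_eq recursive_drop_code assms[THEN recursive_tl] recursive_nth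
        recursive_const) auto
qed

lemma decidable_mem_code:
  assumes "recursive k A" "recursive k B"
  shows "decidable k (\<lambda>xs. mem_code (A xs) (B xs))"
  unfolding mem_code_def
  by (intro recursive_rules1 recursive_length_code recursive_nth_code assms assms[THEN recursive_tl])
    simp

lemmas recursive_rules = recursive_rules1 recursive_cons_code recursive_hd_code recursive_tl_code
  recursive_drop_code recursive_nth_code recursive_length_code decidable_mem_code

section \<open>The normal form theorem\<close>

text \<open>The tag 0 to 5 names the outer constructor; \<open>justified\<close> branches on
  it.\<close>

primrec recf_encode :: "recf \<Rightarrow> nat" where
  "recf_encode Zero = prod_encode (0, 0)"
| "recf_encode Succ = prod_encode (1, 0)"
| "recf_encode (Proj i) = prod_encode (2, i)"
| "recf_encode (Comp f gs) =
    prod_encode (3, prod_encode (recf_encode f, list_encode (map recf_encode gs)))"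
| "recf_encode (PrimRec f g) = prod_encode (4, prod_encode (recf_encode f, recf_encode g))"
| "recf_encode (Mu f) = prod_encode (5, recf_encode f)"

text \<open>Codes the assertion that the term with code \<open>e\<close> takes the value
  \<open>y\<close> on the argument list with code \<open>x\<close>.\<close>

definition fact_code :: "nat \<Rightarrow> nat \<Rightarrow> nat \<Rightarrow> nat" where
  "fact_code e x y = prod_encode (e, prod_encode (x, y))"

text \<open>Whether \<open>fact_code e x y\<close> follows from the facts in the coded list \<open>L\<close> by one rule of
  \<^const>\<open>evaluates\<close>; the cases are in the order of the rules.\<close>

definition justified :: "nat \<Rightarrow> nat \<Rightarrow> nat \<Rightarrow> nat \<Rightarrow> bool" where
  "justified L e x y \<longleftrightarrow>
    (let c = fst_code e; p = snd_code e in
      c = 0 \<and> y = 0 \<or>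
      c = 1 \<and> x \<noteq> 0 \<and> tl_code x = 0 \<and> y = Suc (hd_code x) \<or>
      c = 2 \<and> p < length_code x \<and> y = nth_code x p \<or>
      c = 3 \<and> (\<exists>ys. mem_code (fact_code (fst_code p) ys y) L \<and>
        length_code ys = length_code (snd_code p) \<and>
        (\<forall>i<length_code ys. mem_code (fact_code (nth_code (snd_code p) i) x (nth_code ys i)) L)) \<or>
      c = 4 \<and> x \<noteq> 0 \<and> hd_code x = 0 \<and> mem_code (fact_code (fst_code p) (tl_code x) y) L \<or>
      c = 4 \<and> x \<noteq> 0 \<and> hd_code x \<noteq> 0 \<and>
        (\<exists>z. mem_code (fact_code e (cons_code (hd_code x - 1) (tl_code x)) z) L \<and>
          mem_code (fact_code (snd_code p)
            (cons_code (hd_code x - 1) (cons_code z (tl_code x))) y) L) \<or>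
      c = 5 \<and> mem_code (fact_code p (cons_code y x) 0) L \<and>
        (\<forall>i<y. \<exists>z. mem_code (fact_code p (cons_code i x) (Suc z)) L))"

lemma fact_less:
  assumes "mem_code (fact_code e x y) L"
  shows "x < L" "y < L"
  using mem_code_less[OF assms] le_prod_encode_1[of x y] le_prod_encode_2[of y x]
    le_prod_encode_2[of "prod_encode (x, y)" e]
  by (auto simp: fact_code_def)

text \<open>The tag of \<open>recf_encode r\<close> leaves only the clauses for the outer
  constructor of \<open>r\<close>. These cite facts about \<open>r\<close> or its immediate
  subterms, which \<open>sound\<close> covers, so one rule of \<open>evaluates\<close>
  applies.\<close>

lemma justified_sound:
  assumes sound: "\<And>r xs y. fact_code (recf_encode r) (list_encode xs) y \<in> set l \<Longrightarrow> evaluates r xs y"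
    and just: "justified (list_encode l) (recf_encode r) (list_encode xs) y"
  shows "evaluates r xs y"
proof (cases r)
  case Zero
  then show ?thesis using just by (auto simp: justified_def intro: zero)
next
  case Succ
  then show ?thesis using just by (cases xs) (auto simp: justified_def hd_code_def tl_code_def intro: succ)
next
  case (Proj i)
  then show ?thesis using just by (auto simp: justified_def intro: proj)
next
  case (Comp f gs)
  with just obtain n where n: "fact_code (recf_encode f) n y \<in> set l"
    and len: "length_code n = length gs"
    and nth: "\<And>i. i < length_code n \<Longrightarrow> fact_code (nth_code (list_encode (map recf_encode gs)) i)
      (list_encode xs) (nth_code n i) \<in> set l"
    by (auto simp: justified_def)
  \<comment> \<open>Every number codes a list, so the witness for the intermediate values is a
    genuine list.\<close>
  obtain ys where ys: "n = list_encode ys" by (metis list_decode_inverse)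
  have "list_all2 (\<lambda>g y. evaluates g xs y) gs ys"
    using nth len unfolding ys by (auto simp: list_all2_conv_all_nth intro: sound)
  moreover have "evaluates f ys y" using n unfolding ys by (rule sound)
  ultimately show ?thesis unfolding Comp by (rule comp)
next
  case (PrimRec f g)
  with just obtain m xs' where xs: "xs = m # xs'"
    by (cases xs) (auto simp: justified_def)
  show ?thesis
  proof (cases m)
    case 0
    then show ?thesis using just sound unfolding PrimRec xs
      by (auto simp: justified_def hd_code_def tl_code_def intro: primrec_0)
  next
    case (Suc n)
    with just obtain z where
      "mem_code (fact_code (recf_encode r)
        (cons_code (hd_code (list_encode xs) - 1) (tl_code (list_encode xs))) z) (list_encode l)"
      "mem_code (fact_code (recf_encode g)
        (cons_code (hd_code (list_encode xs) - 1) (cons_code z (tl_code (list_encode xs)))) y)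
        (list_encode l)"
      unfolding PrimRec justified_def by (auto simp: xs hd_code_def)
    then have "evaluates r (n # xs') z" "evaluates g (n # z # xs') y"
      by (auto simp: xs Suc simp del: list_encode.simps intro: sound)
    then show ?thesis unfolding PrimRec xs Suc by (rule primrec_Suc)
  qed
next
  case (Mu f)
  then show ?thesis using just
    by (auto simp: justified_def Let_def simp del: list_encode.simps intro!: mu intro: sound)
qed

section \<open>Soundness and completeness of derivations\<close>

fun derivation :: "nat list \<Rightarrow> bool" where
  "derivation [] \<longleftrightarrow> True"
| "derivation (t # l) \<longleftrightarrow>
    (\<exists>e x y. t = fact_code e x y \<and> justified (list_encode l) e x y) \<and> derivation l"

text \<open>A derivation lists its newest fact first, and each entry cites only entries behind it,
  so induction on the list reduces to one application of \<open>justified_sound\<close> to the head.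
  Entries may mention numbers that code no term; the claim concerns only codes of terms.\<close>

lemma derivation_sound:
  assumes "derivation l" "fact_code (recf_encode r) (list_encode xs) y \<in> set l"
  shows "evaluates r xs y"
  using assms
proof (induction l arbitrary: r xs y)
  case (Cons t l)
  have l: "derivation l" using Cons.prems(1) by simp
  show ?case
  proof (cases "fact_code (recf_encode r) (list_encode xs) y \<in> set l")
    case True
    with l show ?thesis by (rule Cons.IH)
  next
    case False
    with Cons.prems(2) have "t = fact_code (recf_encode r) (list_encode xs) y" by simp
    with Cons.prems(1) have "justified (list_encode l) (recf_encode r) (list_encode xs) y"
      by (auto simp: fact_code_def)
    then show ?thesis using Cons.IH[OF l] by (rule justified_sound[rotated])
  qed
qed simp

text \<open>The list \<open>L\<close> occurs only in positive membership atoms. Hence derivations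
  can be appended.\<close>

lemma justified_mono:
  assumes "justified L e x y" "\<And>t. mem_code t L \<Longrightarrow> mem_code t L'"
  shows "justified L' e x y"
proof -
  have "justified L e x y \<longrightarrow> justified L' e x y"
    unfolding justified_def Let_def
    by (intro disj_mono conj_mono ex_mono all_mono imp_mono; (rule imp_refl | rule impI, erule assms(2)))
  then show ?thesis using assms(1) by blast
qed

lemma derivation_append: "derivation l \<Longrightarrow> derivation l' \<Longrightarrow> derivation (l @ l')"
proof (induction l)
  case (Cons t l)
  then obtain e x y where "t = fact_code e x y" "justified (list_encode l) e x y" by auto
  moreover from this(2) have "justified (list_encode (l @ l')) e x y"
    by (rule justified_mono) simp
  ultimately show ?case using Cons unfolding append_Cons derivation.simps by blast
qed simp

lemma derivation_finite:
  assumes "finite S" "\<And>t. t \<in> S \<Longrightarrow> \<exists>l. derivation l \<and> t \<in> set l"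
  shows "\<exists>l. derivation l \<and> S \<subseteq> set l"
  using assms
proof (induction S)
  case empty
  show ?case by (auto intro: exI[of _ "[]"])
next
  case (insert t S)
  then obtain l l' where "derivation l" "S \<subseteq> set l" "derivation l'" "t \<in> set l'" by (metis insertCI)
  then show ?case by (auto intro!: exI[of _ "l @ l'"] derivation_append)
qed

text \<open>One case of completeness: \<open>S\<close> collects the premises of a rule, their
  derivations are merged into one, and the conclusion is put in front.\<close>

lemma derivation_step:
  assumes "finite S" "\<And>t. t \<in> S \<Longrightarrow> \<exists>l. derivation l \<and> t \<in> set l"
    and "\<And>l. S \<subseteq> set l \<Longrightarrow> justified (list_encode l) e x y"
  shows "\<exists>l. derivation l \<and> fact_code e x y \<in> set l"
proof -
  obtain l where "derivation l" "S \<subseteq> set l" using derivation_finite[OF assms(1,2)] by blast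
  then have "derivation (fact_code e x y # l)" using assms(3) unfolding derivation.simps by blast
  then show ?thesis by (meson list.set_intros(1))
qed

lemma derivation_complete:
  "evaluates r xs y \<Longrightarrow>
    \<exists>l. derivation l \<and> fact_code (recf_encode r) (list_encode xs) y \<in> set l"
proof (induction rule: evaluates.induct)
  case (zero xs)
  show ?case by (rule derivation_step[of "{}"]) (auto simp: justified_def)
next
  case (succ x)
  show ?case by (rule derivation_step[of "{}"]) (auto simp: justified_def hd_code_def tl_code_def)
next
  case (proj i xs)
  then show ?case by (intro derivation_step[of "{}"]) (auto simp: justified_def)
next
  case (comp xs gs ys f z)
  \<comment> \<open>The premises of composition: the outer term on the intermediate values, and each
    inner term on \<open>xs\<close>.\<close>
  let ?S = "insert (fact_code (recf_encode f) (list_encode ys) z)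
    ((\<lambda>i. fact_code (recf_encode (gs ! i)) (list_encode xs) (ys ! i)) ` {..<length ys})"
  show ?case
  proof (rule derivation_step[of ?S])
    show "\<exists>l. derivation l \<and> t \<in> set l" if "t \<in> ?S" for t
      using that comp by (auto simp: list_all2_conv_all_nth)
    show "justified (list_encode l) (recf_encode (Comp f gs)) (list_encode xs) z"
      if "?S \<subseteq> set l" for l
    proof -
      have "length gs = length ys" using comp by (simp add: list_all2_lengthD)
      then show ?thesis
        using that by (auto simp: justified_def intro!: exI[of _ "list_encode ys"])
    qed
  qed simp
next
  case (primrec_0 f xs z g)
  show ?case
    by (rule derivation_step[of "{fact_code (recf_encode f) (list_encode xs) z}"])
      (use primrec_0 in \<open>auto simp: justified_def hd_code_def tl_code_def\<close>)
next
  case (primrec_Suc f g n xs y z)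
  let ?S = "{fact_code (recf_encode (PrimRec f g)) (list_encode (n # xs)) y,
    fact_code (recf_encode g) (list_encode (n # y # xs)) z}"
  show ?case
  proof (rule derivation_step[of ?S])
    show "\<exists>l. derivation l \<and> t \<in> set l" if "t \<in> ?S" for t
      using that primrec_Suc by auto
    show "justified (list_encode l) (recf_encode (PrimRec f g)) (list_encode (Suc n # xs)) z"
      if S: "?S \<subseteq> set l" for l
      using S by (auto simp: justified_def Let_def simp del: list_encode.simps)
  qed simp
next
  case (mu f n xs)
  \<comment> \<open>Choosing one predecessor \<open>z i\<close> of the nonzero value at each
    \<open>i < n\<close> turns the premises of the search into a finite set of facts.\<close>
  then obtain z where z: "\<And>i. i < n \<Longrightarrow>
      \<exists>l. derivation l \<and> fact_code (recf_encode f) (list_encode (i # xs)) (Suc (z i)) \<in> set l"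
    by metis
  let ?S = "insert (fact_code (recf_encode f) (list_encode (n # xs)) 0)
    ((\<lambda>i. fact_code (recf_encode f) (list_encode (i # xs)) (Suc (z i))) ` {..<n})"
  show ?case
  proof (rule derivation_step[of ?S])
    show "\<exists>l. derivation l \<and> t \<in> set l" if "t \<in> ?S" for t
      using that mu z by auto
    show "justified (list_encode l) (recf_encode (Mu f)) (list_encode xs) n"
      if S: "?S \<subseteq> set l" for l
      using S by (fastforce simp: justified_def Let_def simp del: list_encode.simps)
  qed simp
qed

section \<open>The T predicate and its decidability\<close>

definition justified_fact :: "nat \<Rightarrow> nat \<Rightarrow> bool" where
  "justified_fact t L \<longleftrightarrow>
    justified L (fst_code t) (fst_code (snd_code t)) (snd_code (snd_code t))"

text \<open>Pairing is a bijection, so every number is the code of exactly one fact and the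
  existential quantifiers become decoding. The recursion over the list becomes a bounded quantifier
  over positions, as decidability requires.\<close>

lemma derivation_iff:
  "derivation l \<longleftrightarrow> (\<forall>i<length l. justified_fact (l ! i) (list_encode (drop (Suc i) l)))"
proof (induction l)
  case (Cons t l)
  have "(\<exists>e x y. t = fact_code e x y \<and> justified (list_encode l) e x y) \<longleftrightarrow>
      justified_fact t (list_encode l)"
    unfolding justified_fact_def fact_code_def
    by (metis prod_decode_inverse prod_encode_inverse prod.collapse fst_conv snd_conv)
  then show ?case using Cons by (simp add: All_less_Suc2)
qed simp

lemma decidable_justified:
  assumes "recursive k E" "recursive k X" "recursive k Y" "recursive k L"
  shows "decidable k (\<lambda>xs. justified (L xs) (E xs) (X xs) (Y xs))"
proof -
  \<comment> \<open>Every unbounded quantifier in \<open>justified\<close> ranges over a component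
    of some fact in \<open>L\<close>, and such components are below \<open>L\<close> by
    \<open>fact_less\<close>.\<close>
  have bounds:
    "(\<exists>x. mem_code (fact_code e x y) L \<and> Q x) \<longleftrightarrow> (\<exists>x<L. mem_code (fact_code e x y) L \<and> Q x)"
    "(\<exists>y. mem_code (fact_code e x y) L \<and> Q y) \<longleftrightarrow> (\<exists>y<L. mem_code (fact_code e x y) L \<and> Q y)"
    "(\<exists>y. mem_code (fact_code e x (Suc y)) L) \<longleftrightarrow>
      (\<exists>y<L. mem_code (fact_code e x (Suc y)) L)" for e x y L Q
    by (blast dest: fact_less Suc_lessD)+
  show ?thesis
    unfolding justified_def Let_def bounds
    unfolding fact_code_def
    by (intro recursive_rules assms assms[THEN recursive_tl] assms[THEN recursive_tl, THEN recursive_tl];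
        simp)
qed

lemma decidable_derivation:
  assumes "recursive k D"
  shows "decidable k (\<lambda>xs. derivation (list_decode (D xs)))"
proof -
  have "derivation (list_decode d) \<longleftrightarrow>
      (\<forall>i<length_code d. justified_fact (nth_code d i) (drop_code d (Suc i)))" for d
  proof -
    obtain l where "d = list_encode l" by (metis list_decode_inverse)
    then show ?thesis by (simp add: derivation_iff)
  qed
  moreover have "decidable k (\<lambda>xs. \<forall>i<length_code (D xs).
      justified_fact (nth_code (D xs) i) (drop_code (D xs) (Suc i)))"
    unfolding justified_fact_def
    by (intro recursive_rules decidable_justified assms assms[THEN recursive_tl]; simp)
  ultimately show ?thesis by simp
qed

text \<open>Here \<open>d\<close> codes a pair of a derivation and a result. Numbers \<open>e\<close> that code no term may have
  several results; the diagonal argument takes the one given by the least \<open>d\<close>.\<close>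

definition kleene_T :: "nat \<Rightarrow> nat \<Rightarrow> nat \<Rightarrow> bool" where
  "kleene_T e x d \<longleftrightarrow> derivation (list_decode (fst_code d)) \<and>
    mem_code (fact_code e (cons_code x 0) (snd_code d)) (fst_code d)"

lemma decidable_kleene_T:
  assumes "recursive k E" "recursive k X" "recursive k D"
  shows "decidable k (\<lambda>xs. kleene_T (E xs) (X xs) (D xs))"
  unfolding kleene_T_def fact_code_def by (intro recursive_rules decidable_derivation assms)

text \<open>For \<open>e\<close> the code of a term computing \<open>h\<close>, completeness
  provides a witness at every \<open>x\<close>; soundness and uniqueness of values force each
  witness to carry the result \<open>h x\<close>.\<close>

lemma normal_form:
  assumes "computable h"
  obtains e where "\<And>x. \<exists>d. kleene_T e x d" "\<And>x d. kleene_T e x d \<Longrightarrow> snd_code d = h x"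
proof -
  obtain r where r: "\<And>x. evaluates r [x] (h x)" using assms unfolding computable_def by blast
  have T: "kleene_T (recf_encode r) x (prod_encode (list_encode l, y)) \<longleftrightarrow>
      derivation l \<and> fact_code (recf_encode r) (list_encode [x]) y \<in> set l" for x l y
    \<comment> \<open>As 0 codes the empty list, \<open>cons_code x 0\<close> is the code of
      \<open>[x]\<close>.\<close>
    using cons_code[of x "[]"] by (simp add: kleene_T_def)
  show thesis
  proof (rule that)
    show "\<exists>d. kleene_T (recf_encode r) x d" for x using derivation_complete[OF r, of x] T by blast
    fix x d assume d: "kleene_T (recf_encode r) x d"
    obtain l y where ly: "d = prod_encode (list_encode l, y)"
      by (metis list_decode_inverse prod_encode_fst_snd)
    have "evaluates r [x] y" using d derivation_sound unfolding ly T by blast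
    then show "snd_code d = h x" using evaluates_unique[OF r] ly by simp
  qed
qed

section \<open>Diagonalization\<close>

lemma approximable_from_below_diagonal:
  assumes "approximable_from_below f"
  shows "\<exists>j. approximable_from_below j \<and> (\<forall>h. computable h \<longrightarrow> j \<noteq> f \<circ> h)"
proof -
  obtain g where g: "computable2 g" "\<And>x s. g x s \<le> g x (Suc s)" "\<And>x. (\<lambda>s. g x s) \<longlonglongrightarrow> f x"
    using assms unfolding approximable_from_below_def by blast
  \<comment> \<open>The search cut off at \<open>s\<close>: the least witness if there is one up to
    \<open>s\<close>, and otherwise \<open>s\<close>, which is then no witness. The cutoff keeps the
    search total.\<close>
  define D where "D e s = (LEAST d. kleene_T e e d \<or> d = s)" for e s
  define G where "G e s = (if kleene_T e e (D e s) then Suc (g (snd_code (D e s)) s) else 0)" for e s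
  define j where
    "j e = (if \<exists>d. kleene_T e e d then Suc (f (snd_code (LEAST d. kleene_T e e d))) else 0)" for e
  have D_eq: "D e s = (LEAST d. kleene_T e e d)" if "kleene_T e e d" "d \<le> s" for e d s
    unfolding D_def
  proof (rule Least_equality)
    show "kleene_T e e (LEAST d. kleene_T e e d) \<or> (LEAST d. kleene_T e e d) = s"
      using LeastI[of "kleene_T e e", OF that(1)] by simp
    show "(LEAST d. kleene_T e e d) \<le> d'" if "kleene_T e e d' \<or> d' = s" for d'
      using that \<open>kleene_T e e d\<close> \<open>d \<le> s\<close> Least_le[of "kleene_T e e"] by (meson order_trans)
  qed
  have D_le: "D e s \<le> s" for e s unfolding D_def by (rule Least_le) simp
  have "computable2 G"
    unfolding G_def D_def
    by (intro computable2I recursive_if recursive_Suc recursive_app2[OF g(1)] recursive_snd_code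
      decidable_kleene_T recursive_Least
      decidable_disj decidable_eq recursive_nth recursive_nth_tl recursive_const) auto
  moreover have "G e s \<le> G e (Suc s)" for e s
  proof (cases "kleene_T e e (D e s)")
    case True
    \<comment> \<open>A witness found at stage \<open>s\<close> is at most \<open>s\<close>, hence
      is the least witness overall and never changes; from then on \<open>G e\<close> inherits its
      monotonicity from \<open>g\<close>.\<close>
    have "D e (Suc s) = D e s"
      using D_eq[OF True, of s] D_eq[OF True, of "Suc s"] D_le[of e s] by simp
    then show ?thesis using True g(2) by (simp add: G_def)
  qed (simp add: G_def)
  moreover have "(\<lambda>s. G e s) \<longlonglongrightarrow> j e" for e
  proof (cases "\<exists>d. kleene_T e e d")
    case True
    let ?d = "LEAST d. kleene_T e e d"
    have T: "kleene_T e e ?d" using True by (rule LeastI_ex)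
    \<comment> \<open>In the discrete topology convergence means being eventually constant. Once
      \<open>s\<close> also passes \<open>?d\<close>, \<open>G e s\<close> has reached
      \<open>j e\<close>.\<close>
    have "\<forall>\<^sub>F s in sequentially. g (snd_code ?d) s = f (snd_code ?d)"
      using g(3) by (simp add: tendsto_discrete)
    then have "\<forall>\<^sub>F s in sequentially. G e s = j e"
      using eventually_ge_at_top[of ?d]
    proof eventually_elim
      case (elim s)
      have "D e s = ?d" using D_eq[OF T elim(2)] .
      then show ?case using elim(1) T True by (simp add: G_def j_def)
    qed
    then show ?thesis by (simp add: tendsto_discrete)
  qed (simp add: G_def j_def)
  ultimately have "approximable_from_below j" unfolding approximable_from_below_def by blast
  moreover have "j \<noteq> f \<circ> h" if h: "computable h" for h
  proof
    assume eq: "j = f \<circ> h"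
    \<comment> \<open>The diagonal choice: the index \<open>e\<close> of \<open>h\<close> also
      serves as the argument. There \<open>j e\<close> exceeds \<open>f (h e)\<close> by
      one.\<close>
    obtain e where e: "\<exists>d. kleene_T e e d" "\<And>d. kleene_T e e d \<Longrightarrow> snd_code d = h e"
      using normal_form[OF h] by metis
    then have "snd_code (LEAST d. kleene_T e e d) = h e" using LeastI_ex by metis
    then have "j e = Suc (f (h e))" using e(1) by (simp add: j_def)
    then show False using eq by simp
  qed
  ultimately show ?thesis by blast
qed

theorem theorem3p11:
  shows "(\<nexists>\<psi>. m_complete {f. approximable_from_below f} \<psi>) \<and>
    (\<forall>f. approximable_from_below f \<longrightarrow>
      (\<exists>j. approximable_from_below j \<and> \<not> (\<exists>h. computable h \<and> j = f \<circ> h)))"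
  \<comment> \<open>A complete function would itself be approximable from below, and its diagonal
    function would not reduce to it.\<close>
  using approximable_from_below_diagonal unfolding m_complete_def by blast

end
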